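(* Let $K$ be an arbitrary field, let $i,j,k\in\{0,1\}$, and let $\mathcal A$ be a 3-dimensional curled algebra of type $(i,j,k)$ over $K$ with respect to a linear basis $\{e,f,g\}$. Put $A=ef$, $B=eg$, $C=fe$, $D=fg$, $E=ge$, $F=gf$. Then $\mathcal A$ is endo-commutative if and only if all of the following equalities hold in $\mathcal A$: (I) \[ \begin{aligned} &A^2=ij\,A,\quad B^2=ik\,B,\quad C^2=ij\,C,\quad D^2=jk\,D,\quad E^2=ik\,E,\quad F^2=jk\,F,\\ &AB+BA=i\,e(D+F),\qquad CE+EC=i\,(D+F)e,\\ &CD+DC=j\,f(B+E),\qquad AF+FA=j\,(B+E)f,\\ &EF+FE=k\,g(A+C),\qquad BD+DB=k\,(A+C)g,\\ &i\,Ae=i\,eC,\qquad i\,Be=i\,eE,\qquad j\,Cf=j\,fA,\qquad j\,Df=j\,fF,\qquad k\,Eg=k\,gB,\qquad k\,Fg=k\,gD; \end{aligned} \] and (II) \[ \begin{aligned} &BC+BA+EC-AE=i\,(eF+Fe),\\ &DA+FA+DC-CF=j\,(Ef+fE),\\ &DB+FB+FE-ED=k\,(Cg+gC). \end{aligned} \]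
   Context: An algebra over a field $K$ means a $K$-vector space with a $K$-bilinear multiplication, not necessarily associative, commutative or unital; $x^2$ denotes $xx$. An algebra $\mathcal A$ is curled if for every $x\in\mathcal A$ the elements $x$ and $x^2$ are linearly dependent over $K$. A 3-dimensional curled algebra $\mathcal A$ over $K$ is of type $(i,j,k)\in\{0,1\}^3$ with respect to a linear basis $\{e,f,g\}$ if $e^2=ie$, $f^2=jf$ and $g^2=kg$ (here $0,1$ are regarded as elements of $K$). An algebra $\mathcal A$ is endo-commutative if $x^2y^2=(xy)^2$ for all $x,y\in\mathcal A$. Juxtaposition of elements denotes the product in $\mathcal A$ (e.g. $AB$ is the product of $A=ef$ and $B=eg$, and $e(D+F)$ is the product of $e$ and $D+F$), while $i,j,k$ act as scalars. *)

theory Defs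
  imports Complex_Main
begin

locale algebra_over_field = vector_space scale
  for scale :: "'k::field \<Rightarrow> 'a::ab_group_add \<Rightarrow> 'a" +
  fixes mul :: "'a \<Rightarrow> 'a \<Rightarrow> 'a"
  assumes linear_mul_left: "Vector_Spaces.linear scale scale (\<lambda>x. mul x y)"
    and linear_mul_right: "Vector_Spaces.linear scale scale (\<lambda>y. mul x y)"
begin

text \<open>
  Linear dependence is that of the family \<open>(x, x\<^sup>2)\<close>, not of the set \<open>{x, x\<^sup>2}\<close>: if
  \<open>x\<^sup>2 = x \<noteq> 0\<close>, the set is the linearly independent singleton \<open>{x}\<close>, whereas the family
  is dependent.
\<close>

definition curled :: bool where
  "curled \<longleftrightarrow>
    (\<forall>x. \<exists>a b. (a \<noteq> 0 \<or> b \<noteq> 0) \<and> scale a x + scale b (mul x x) = 0)"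

definition endo_commutative :: bool where
  "endo_commutative \<longleftrightarrow>
    (\<forall>x y. mul (mul x x) (mul y y) = mul (mul x y) (mul x y))"

definition is_basis3 :: "'a \<Rightarrow> 'a \<Rightarrow> 'a \<Rightarrow> bool" where
  "is_basis3 e f g \<longleftrightarrow>
    distinct [e, f, g] \<and> independent {e, f, g} \<and> span {e, f, g} = UNIV"

lemma dim_UNIV_if_is_basis3:
  assumes "is_basis3 e f g"
  shows "dim UNIV = 3"
  using assms dim_eq_card[of "{e, f, g}" UNIV] by (simp add: is_basis3_def)

definition of_type :: "'k \<times> 'k \<times> 'k \<Rightarrow> 'a \<Rightarrow> 'a \<Rightarrow> 'a \<Rightarrow> bool" where
  "of_type = (\<lambda>(i, j, k) e f g.
    i \<in> {0, 1} \<and> j \<in> {0, 1} \<and> k \<in> {0, 1} \<and> is_basis3 e f g \<and>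
    mul e e = scale i e \<and> mul f f = scale j f \<and> mul g g = scale k g)"

end

end

theory Submission
  imports Defs
begin

text \<open>
  Endo-commutativity says that the defect \<open>x\<^sup>2y\<^sup>2 - (xy)\<^sup>2\<close> vanishes for all \<open>x\<close> and \<open>y\<close>. The
  defect is a quadratic map in \<open>x\<close> for fixed \<open>y\<close>, and in \<open>y\<close> for fixed \<open>x\<close>. A quadratic map
  vanishes on the span of a set \<open>S\<close> as soon as it vanishes on \<open>S\<close> and its polar form vanishes on
  pairs from \<open>S\<close> (\<open>quadratic_map_eq_0_on_span\<close>), and polar forms are obtained by additions
  and subtractions alone. No scalars have to be chosen, so the argument is the same over every
  field, however small.

  Polarising in both variables turns endo-commutativity into four families of identities between
  elements of a spanning set (\<open>endo_commutative_iff_on_spanning_set\<close>). They are the coefficients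
  of the defect of two generic linear combinations of that set. For a basis \<open>e\<close>, \<open>f\<close>, \<open>g\<close> with
  \<open>e\<^sup>2 = ie\<close>, \<open>f\<^sup>2 = jf\<close>, \<open>g\<^sup>2 = kg\<close> there are 36 coefficients, one for each pair of
  quadratic monomials:

  \<^item> a square against a square gives the equations for \<open>A\<^sup>2, \<dots>, F\<^sup>2\<close>, and three trivial ones;
  \<^item> a square against a mixed monomial without that variable gives the equations with
    \<open>AB + BA, \<dots>, BD + DB\<close>;
  \<^item> a square against a mixed monomial with that variable gives the equations
    \<open>i Ae = i eC, \<dots>, k Fg = k gD\<close>, each of them twice;
  \<^item> a mixed monomial against itself gives sums of two equations of the first kind;
  \<^item> two different mixed monomials, in one order, give (II), and in the other order the same
    equations up to equations of the second kind.
\<close>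

section \<open>Quadratic maps\<close>

text \<open>
  The polar form vanishes on pairs from the span by linearity in each argument. There the
  map itself is therefore additive, and its zeros in the span form a subspace.
\<close>

lemma (in vector_space) quadratic_map_eq_0_on_span:
  assumes scale: "\<And>a x. q (scale a x) = scale (a\<^sup>2) (q x)"
    and add: "\<And>x y. q (x + y) = q x + q y + b x y"
    and linear_left: "\<And>y. Vector_Spaces.linear scale scale (\<lambda>x. b x y)"
    and linear_right: "\<And>x. Vector_Spaces.linear scale scale (b x)"
    and zero: "\<And>s. s \<in> S \<Longrightarrow> q s = 0"
    and polar_zero: "\<And>s t. s \<in> S \<Longrightarrow> t \<in> S \<Longrightarrow> b s t = 0"
    and "x \<in> span S"
  shows "q x = 0"
proof -
  interpret pair: vector_space_pair scale scale ..
  have "b s y = 0" if "s \<in> S" "y \<in> span S" for s y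
    using pair.linear_eq_0_on_span[OF linear_right] polar_zero that by blast
  then have polar: "b u y = 0" if "u \<in> span S" "y \<in> span S" for u y
    using pair.linear_eq_0_on_span[OF linear_left] that by blast
  have "subspace {u \<in> span S. q u = 0}"
    using scale[of 0 0] by (auto simp: subspace_def add polar scale span_zero span_add span_scale)
  then have "span S \<subseteq> {u \<in> span S. q u = 0}"
    by (intro span_minimal) (auto simp: zero span_base)
  with \<open>x \<in> span S\<close> show ?thesis by blast
qed

section \<open>The defect of endo-commutativity and its polarisations\<close>

context algebra_over_field
begin

lemma mul_add_left: "mul (x + y) z = mul x z + mul y z"
  by (rule module_hom.add[OF linear_mul_left[THEN Vector_Spaces.linear.axioms(3)]])

lemma mul_add_right: "mul z (x + y) = mul z x + mul z y"
  by (rule module_hom.add[OF linear_mul_right[THEN Vector_Spaces.linear.axioms(3)]])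

lemma mul_scale_left: "mul (scale a x) z = scale a (mul x z)"
  by (rule module_hom.scale[OF linear_mul_left[THEN Vector_Spaces.linear.axioms(3)]])

lemma mul_scale_right: "mul z (scale a x) = scale a (mul z x)"
  by (rule module_hom.scale[OF linear_mul_right[THEN Vector_Spaces.linear.axioms(3)]])

lemmas mul_bilinear = mul_add_left mul_add_right mul_scale_left mul_scale_right

definition defect :: "'a \<Rightarrow> 'a \<Rightarrow> 'a" where
  "defect x y = mul (mul x x) (mul y y) - mul (mul x y) (mul x y)"

text \<open>The polar form of \<open>z \<mapsto> z\<^sup>2\<close>.\<close>

definition anticommutator :: "'a \<Rightarrow> 'a \<Rightarrow> 'a" where
  "anticommutator x y = mul x y + mul y x"

definition defect_polar_left :: "'a \<Rightarrow> 'a \<Rightarrow> 'a \<Rightarrow> 'a" where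
  "defect_polar_left x x' y =
    mul (anticommutator x x') (mul y y) - anticommutator (mul x y) (mul x' y)"

definition defect_polar_right :: "'a \<Rightarrow> 'a \<Rightarrow> 'a \<Rightarrow> 'a" where
  "defect_polar_right x y y' =
    mul (mul x x) (anticommutator y y') - anticommutator (mul x y) (mul x y')"

definition defect_polar :: "'a \<Rightarrow> 'a \<Rightarrow> 'a \<Rightarrow> 'a \<Rightarrow> 'a" where
  "defect_polar x x' y y' =
    mul (anticommutator x x') (anticommutator y y')
      - anticommutator (mul x y) (mul x' y') - anticommutator (mul x y') (mul x' y)"

lemmas defect_defs =
  defect_def anticommutator_def defect_polar_left_def defect_polar_right_def defect_polar_def

lemmas expand_defect = defect_defs mul_bilinear power2_eq_square

lemma endo_commutative_iff_defect: "endo_commutative \<longleftrightarrow> (\<forall>x y. defect x y = 0)"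
  by (simp add: endo_commutative_def defect_def)

lemma defect_add_left: "defect (x + x') y = defect x y + defect x' y + defect_polar_left x x' y"
  by (simp add: expand_defect algebra_simps)

lemma defect_add_right: "defect x (y + y') = defect x y + defect x y' + defect_polar_right x y y'"
  by (simp add: expand_defect algebra_simps)

lemma defect_polar_right_add:
  "defect_polar_right (x + x') y y' =
    defect_polar_right x y y' + defect_polar_right x' y y' + defect_polar x x' y y'"
  by (simp add: expand_defect algebra_simps)

lemma defect_scale_left: "defect (scale a x) y = scale (a\<^sup>2) (defect x y)"
  by (simp add: expand_defect algebra_simps)

lemma defect_scale_right: "defect x (scale a y) = scale (a\<^sup>2) (defect x y)"
  by (simp add: expand_defect algebra_simps)

lemma defect_polar_right_scale:
  "defect_polar_right (scale a x) y y' = scale (a\<^sup>2) (defect_polar_right x y y')"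
  by (simp add: expand_defect algebra_simps)

lemma linearI:
  assumes "\<And>x y. h (x + y) = h x + h y" and "\<And>a x. h (scale a x) = scale a (h x)"
  shows "Vector_Spaces.linear scale scale h"
  using assms
  by (simp add: Vector_Spaces.linear_def module_hom_def module_hom_axioms_def
      vector_space_axioms module_axioms)

lemma linear_defect_polars:
  "Vector_Spaces.linear scale scale (\<lambda>x. defect_polar_left x x' y)"
  "Vector_Spaces.linear scale scale (\<lambda>x'. defect_polar_left x x' y)"
  "Vector_Spaces.linear scale scale (\<lambda>y. defect_polar_right x y y')"
  "Vector_Spaces.linear scale scale (\<lambda>y'. defect_polar_right x y y')"
  "Vector_Spaces.linear scale scale (\<lambda>x. defect_polar x x' y y')"
  "Vector_Spaces.linear scale scale (\<lambda>x'. defect_polar x x' y y')"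
  by (rule linearI; simp add: expand_defect algebra_simps)+

text \<open>
  The converse extends the first argument from \<open>S\<close> to its span while the second stays in
  \<open>S\<close>, and then the second. The condition on \<open>defect_polar\<close> is what carries the right polar
  form through the first of these steps.
\<close>

lemma endo_commutative_iff_on_spanning_set:
  assumes "span S = UNIV"
  shows "endo_commutative \<longleftrightarrow>
    (\<forall>x\<in>S. \<forall>y\<in>S. defect x y = 0) \<and>
    (\<forall>x\<in>S. \<forall>x'\<in>S. \<forall>y\<in>S. defect_polar_left x x' y = 0) \<and>
    (\<forall>x\<in>S. \<forall>y\<in>S. \<forall>y'\<in>S. defect_polar_right x y y' = 0) \<and>
    (\<forall>x\<in>S. \<forall>x'\<in>S. \<forall>y\<in>S. \<forall>y'\<in>S. defect_polar x x' y y' = 0)"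
    (is "_ \<longleftrightarrow> ?R")
proof
  assume "endo_commutative"
  then have defect: "defect x y = 0" for x y
    by (simp add: endo_commutative_iff_defect)
  have right: "defect_polar_right x y y' = 0" for x y y'
    using defect_add_right[of x y y'] by (simp add: defect)
  show ?R
    using defect_add_left defect_polar_right_add by (auto simp: defect right)
next
  assume R: ?R
  have spans: "x \<in> span S" for x
    using assms by simp
  have left: "defect x y = 0" if "y \<in> S" for x y
    by (rule quadratic_map_eq_0_on_span[where q = "\<lambda>x. defect x y"
          and b = "\<lambda>x x'. defect_polar_left x x' y" and S = S])
      (use R that in \<open>auto simp: defect_scale_left defect_add_left linear_defect_polars spans\<close>)
  have right: "defect_polar_right x y y' = 0" if "y \<in> S" "y' \<in> S" for x y y'
    by (rule quadratic_map_eq_0_on_span[where q = "\<lambda>x. defect_polar_right x y y'"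
          and b = "\<lambda>x x'. defect_polar x x' y y'" and S = S])
      (use R that in
        \<open>auto simp: defect_polar_right_scale defect_polar_right_add linear_defect_polars spans\<close>)
  have "defect x y = 0" for x y
    by (rule quadratic_map_eq_0_on_span[where q = "defect x"
          and b = "defect_polar_right x" and S = S])
      (use left right in
        \<open>auto simp: defect_scale_right defect_add_right linear_defect_polars spans\<close>)
  then show "endo_commutative"
    by (simp add: endo_commutative_iff_defect)
qed

section \<open>The coefficients over a basis of three elements\<close>

lemma defect_polar_symmetries:
  "defect_polar_left x' x y = defect_polar_left x x' y"
  "defect_polar_right x y' y = defect_polar_right x y y'"
  "defect_polar x' x y y' = defect_polar x x' y y'"
  "defect_polar x x' y' y = defect_polar x x' y y'"
  by (simp_all add: defect_defs add.commute algebra_simps)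

text \<open>On the diagonal a polar form is twice the quadratic map that it comes from.\<close>

lemma defect_polar_diagonal:
  "defect_polar_left x x y = defect x y + defect x y"
  "defect_polar_right x y y = defect x y + defect x y"
  "defect_polar x x y y' = defect_polar_right x y y' + defect_polar_right x y y'"
  "defect_polar x x' y y = defect_polar_left x x' y + defect_polar_left x x' y"
  by (simp_all add: defect_defs mul_bilinear algebra_simps)

lemma defect_self: "defect x x = 0"
  by (simp add: defect_def)

lemma endo_commutative_iff_coefficients:
  assumes "span {e, f, g} = UNIV"
  shows "endo_commutative \<longleftrightarrow>
    (defect e f = 0 \<and> defect e g = 0 \<and> defect f e = 0 \<and>
     defect f g = 0 \<and> defect g e = 0 \<and> defect g f = 0) \<and>
    (\<forall>y\<in>{e, f, g}. defect_polar_left e f y = 0 \<and> defect_polar_left e g y = 0 \<and>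
      defect_polar_left f g y = 0) \<and>
    (\<forall>x\<in>{e, f, g}. defect_polar_right x e f = 0 \<and> defect_polar_right x e g = 0 \<and>
      defect_polar_right x f g = 0) \<and>
    (\<forall>(x, x')\<in>{(e, f), (e, g), (f, g)}. defect_polar x x' e f = 0 \<and>
      defect_polar x x' e g = 0 \<and> defect_polar x x' f g = 0)"
    (is "_ \<longleftrightarrow> ?C")
proof
  assume "endo_commutative"
  then show ?C
    by (simp add: endo_commutative_iff_on_spanning_set[OF assms])
next
  assume C: ?C
  \<comment> \<open>Oriented instances, because the symmetries themselves would make rewriting loop.\<close>
  note swap =
    defect_polar_symmetries(1)[of f e] defect_polar_symmetries(1)[of g e]
    defect_polar_symmetries(1)[of g f]
    defect_polar_symmetries(2)[of _ f e] defect_polar_symmetries(2)[of _ g e]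
    defect_polar_symmetries(2)[of _ g f]
    defect_polar_symmetries(3)[of f e] defect_polar_symmetries(3)[of g e]
    defect_polar_symmetries(3)[of g f]
    defect_polar_symmetries(4)[of _ _ f e] defect_polar_symmetries(4)[of _ _ g e]
    defect_polar_symmetries(4)[of _ _ g f]
  show "endo_commutative"
    unfolding endo_commutative_iff_on_spanning_set[OF assms]
    using C by (simp add: swap defect_polar_diagonal defect_self)
qed

context
  fixes e f :: 'a and i j :: 'k
  assumes square_e: "mul e e = scale i e" and square_f: "mul f f = scale j f"
begin

lemma defect_eq_0_iff:
  "defect e f = 0 \<longleftrightarrow> mul (mul e f) (mul e f) = scale (i * j) (mul e f)"
  by (auto simp: defect_def square_e square_f mul_bilinear mult.commute)

lemma defect_polar_same:
  "defect_polar e f e f = - defect e f - defect f e"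
  by (simp add: expand_defect square_e square_f algebra_simps)

end

context
  fixes e :: 'a and i :: 'k
  assumes square_e: "mul e e = scale i e"
begin

lemma defect_polar_left_disjoint_eq_0_iff:
  "defect_polar_left f g e = 0 \<longleftrightarrow>
    mul (mul f e) (mul g e) + mul (mul g e) (mul f e) = scale i (mul (mul f g + mul g f) e)"
  by (auto simp: defect_defs square_e mul_bilinear)

lemma defect_polar_right_disjoint_eq_0_iff:
  "defect_polar_right e f g = 0 \<longleftrightarrow>
    mul (mul e f) (mul e g) + mul (mul e g) (mul e f) = scale i (mul e (mul f g + mul g f))"
  by (auto simp: expand_defect square_e algebra_simps)

text \<open>
  The product \<open>(fe)e\<close> cancels in the coefficient of \<open>ef\<close> against \<open>e\<^sup>2\<close>, and \<open>e(ef)\<close> in that of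
  \<open>e\<^sup>2\<close> against \<open>ef\<close>. What remains is the same equation.
\<close>

lemma defect_polar_left_overlap_eq_0_iff:
  "defect_polar_left e f e = 0 \<longleftrightarrow> scale i (mul (mul e f) e) = scale i (mul e (mul f e))"
  by (simp add: expand_defect square_e algebra_simps)

lemma defect_polar_right_overlap_eq_0_iff:
  "defect_polar_right e e f = 0 \<longleftrightarrow> scale i (mul (mul e f) e) = scale i (mul e (mul f e))"
  by (auto simp: expand_defect square_e algebra_simps)

lemma defect_polar_overlap_eq_0_iff:
  "defect_polar e g e f = 0 \<longleftrightarrow>
    mul (mul e g) (mul f e) + mul (mul e g) (mul e f) + mul (mul g e) (mul f e)
      - mul (mul e f) (mul g e) = scale i (mul e (mul g f) + mul (mul g f) e)"
proof -
  have "defect_polar e g e f =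
    mul (mul e g) (mul f e) + mul (mul e g) (mul e f) + mul (mul g e) (mul f e)
      - mul (mul e f) (mul g e) - scale i (mul e (mul g f) + mul (mul g f) e)"
    by (simp add: expand_defect square_e algebra_simps)
  then show ?thesis by simp
qed

text \<open>
  The products of the form \<open>(e_)(_e)\<close> and \<open>(_e)(e_)\<close> cancel in the sum of the coefficients of
  \<open>ef\<close> against \<open>eg\<close> and of \<open>eg\<close> against \<open>ef\<close>. The rest of the sum comes from coefficients
  with \<open>e\<^sup>2\<close>, so that once these vanish, one of the two orders suffices.
\<close>

lemma defect_polar_exchange:
  "defect_polar e f e g =
    - defect_polar e g e f - defect_polar_right e f g - defect_polar_left f g e"
  by (simp add: expand_defect square_e algebra_simps)

end

end

section \<open>The characterisation\<close>

theorem theorem3p1: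
  fixes scale :: "'k::field \<Rightarrow> 'a::ab_group_add \<Rightarrow> 'a"  (infixr "*s" 75)
    and mul :: "'a \<Rightarrow> 'a \<Rightarrow> 'a"  (infixl "\<cdot>" 78)
    and i j k :: 'k
    and e f g A B C D E F :: 'a
  assumes "algebra_over_field scale mul"
    and "algebra_over_field.curled scale mul"
    and "algebra_over_field.of_type scale mul (i, j, k) e f g"
    and "A = e \<cdot> f" and "B = e \<cdot> g" and "C = f \<cdot> e"
    and "D = f \<cdot> g" and "E = g \<cdot> e" and "F = g \<cdot> f"
  shows "algebra_over_field.endo_commutative mul \<longleftrightarrow>
    \<comment> \<open>(I)\<close>
    (A \<cdot> A = (i * j) *s A \<and> B \<cdot> B = (i * k) *s B \<and> C \<cdot> C = (i * j) *s C \<and>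
     D \<cdot> D = (j * k) *s D \<and> E \<cdot> E = (i * k) *s E \<and> F \<cdot> F = (j * k) *s F \<and>
     A \<cdot> B + B \<cdot> A = i *s (e \<cdot> (D + F)) \<and> C \<cdot> E + E \<cdot> C = i *s ((D + F) \<cdot> e) \<and>
     C \<cdot> D + D \<cdot> C = j *s (f \<cdot> (B + E)) \<and> A \<cdot> F + F \<cdot> A = j *s ((B + E) \<cdot> f) \<and>
     E \<cdot> F + F \<cdot> E = k *s (g \<cdot> (A + C)) \<and> B \<cdot> D + D \<cdot> B = k *s ((A + C) \<cdot> g) \<and>
     i *s (A \<cdot> e) = i *s (e \<cdot> C) \<and> i *s (B \<cdot> e) = i *s (e \<cdot> E) \<and>
     j *s (C \<cdot> f) = j *s (f \<cdot> A) \<and> j *s (D \<cdot> f) = j *s (f \<cdot> F) \<and>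
     k *s (E \<cdot> g) = k *s (g \<cdot> B) \<and> k *s (F \<cdot> g) = k *s (g \<cdot> D)) \<and>
    \<comment> \<open>(II)\<close>
    (B \<cdot> C + B \<cdot> A + E \<cdot> C - A \<cdot> E = i *s (e \<cdot> F + F \<cdot> e) \<and>
     D \<cdot> A + F \<cdot> A + D \<cdot> C - C \<cdot> F = j *s (E \<cdot> f + f \<cdot> E) \<and>
     D \<cdot> B + F \<cdot> B + F \<cdot> E - E \<cdot> D = k *s (C \<cdot> g + g \<cdot> C))"
proof -
  interpret algebra_over_field scale mul by fact
  have spans: "span {e, f, g} = UNIV"
    and squares: "e \<cdot> e = i *s e" "f \<cdot> f = j *s f" "g \<cdot> g = k *s g"
    using assms(3) by (simp_all add: of_type_def is_basis3_def)
  note overlap = defect_polar_right_overlap_eq_0_iff defect_polar_left_overlap_eq_0_iff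
  have right_overlap_as_left:
    "defect_polar_right e e f = 0 \<longleftrightarrow> defect_polar_left e f e = 0"
    "defect_polar_right e e g = 0 \<longleftrightarrow> defect_polar_left e g e = 0"
    "defect_polar_right f e f = 0 \<longleftrightarrow> defect_polar_left e f f = 0"
    "defect_polar_right f f g = 0 \<longleftrightarrow> defect_polar_left f g f = 0"
    "defect_polar_right g e g = 0 \<longleftrightarrow> defect_polar_left e g g = 0"
    "defect_polar_right g f g = 0 \<longleftrightarrow> defect_polar_left f g g = 0"
    using overlap[OF squares(1), of f] overlap[OF squares(1), of g]
      overlap[OF squares(2), of e] overlap[OF squares(2), of g]
      overlap[OF squares(3), of e] overlap[OF squares(3), of f]
    by (simp_all add: defect_polar_symmetries(1)[of f e] defect_polar_symmetries(1)[of g e]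
        defect_polar_symmetries(1)[of g f] defect_polar_symmetries(2)[of _ f e]
        defect_polar_symmetries(2)[of _ g e] defect_polar_symmetries(2)[of _ g f])
  have exchange:
    "defect_polar e f e g =
      - defect_polar e g e f - defect_polar_right e f g - defect_polar_left f g e"
    "defect_polar e f f g =
      - defect_polar f g e f - defect_polar_right f e g - defect_polar_left e g f"
    "defect_polar e g f g =
      - defect_polar f g e g - defect_polar_right g e f - defect_polar_left e f g"
    using defect_polar_exchange[OF squares(1), of f g] defect_polar_exchange[OF squares(2), of e g]
      defect_polar_exchange[OF squares(3), of e f]
    by (simp_all add: defect_polar_symmetries(3)[of f e] defect_polar_symmetries(3)[of g e]
        defect_polar_symmetries(3)[of g f] defect_polar_symmetries(4)[of _ _ f e]
        defect_polar_symmetries(4)[of _ _ g e] defect_polar_symmetries(4)[of _ _ g f])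
  note same = defect_polar_same[OF squares(1,2)] defect_polar_same[OF squares(1,3)]
    defect_polar_same[OF squares(2,3)]
  \<comment> \<open>One representative of each equation, in the order of (I) and (II).\<close>
  have "endo_commutative \<longleftrightarrow>
    (defect e f = 0 \<and> defect e g = 0 \<and> defect f e = 0 \<and>
     defect f g = 0 \<and> defect g e = 0 \<and> defect g f = 0 \<and>
     defect_polar_right e f g = 0 \<and> defect_polar_left f g e = 0 \<and>
     defect_polar_right f e g = 0 \<and> defect_polar_left e g f = 0 \<and>
     defect_polar_right g e f = 0 \<and> defect_polar_left e f g = 0 \<and>
     defect_polar_left e f e = 0 \<and> defect_polar_left e g e = 0 \<and>
     defect_polar_left f e f = 0 \<and> defect_polar_left f g f = 0 \<and>
     defect_polar_left g e g = 0 \<and> defect_polar_left g f g = 0) \<and>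
    (defect_polar e g e f = 0 \<and> defect_polar f g f e = 0 \<and> defect_polar g f g e = 0)"
    unfolding endo_commutative_iff_coefficients[OF spans]
      defect_polar_symmetries(1)[of f e] defect_polar_symmetries(1)[of g e]
      defect_polar_symmetries(1)[of g f] defect_polar_symmetries(3)[of g f]
      defect_polar_symmetries(4)[of _ _ f e] defect_polar_symmetries(4)[of _ _ g e]
    by (auto simp: right_overlap_as_left exchange same)
  then show ?thesis
    unfolding assms(4-9)
      defect_eq_0_iff[OF squares(1,2)] defect_eq_0_iff[OF squares(1,3)]
      defect_eq_0_iff[OF squares(2,1)] defect_eq_0_iff[OF squares(2,3)]
      defect_eq_0_iff[OF squares(3,1)] defect_eq_0_iff[OF squares(3,2)]
      squares[THEN defect_polar_overlap_eq_0_iff]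
      \<comment> \<open>The overlapping case precedes the disjoint one, whose left-hand side also matches
        \<open>defect_polar_left f e f\<close>.\<close>
      squares[THEN defect_polar_left_overlap_eq_0_iff]
    unfolding squares[THEN defect_polar_left_disjoint_eq_0_iff]
      squares[THEN defect_polar_right_disjoint_eq_0_iff]
    by (simp only: ac_simps)
qed

end
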